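(* Let $m,n$ be positive integers and let $\underline{d}=(d_1,\ldots,d_m)$ be a list of nonnegative integers with $\max_{1\le i\le m} d_i>0$. Let $M(\lambda)\in\mathbb{C}[\lambda]^{m\times(m+n)}_{\underline{d}}$ be a minimal basis with $\operatorname{rank}(M_{\underline{d}})=m$, where $M_{\underline{d}}$ is the leading row-wise coefficient matrix of $M(\lambda)$. Let $d'$ be the largest right minimal index of $M(\lambda)$ and let $T_{d'}$ be the $d'$th trimmed Sylvester matrix of $M(\lambda)$. Then $$\sigma_{(d'm+\sum_{i=1}^m d_i)}(T_{d'})\le\inf_{\lambda_0\in\mathbb{C}}\sigma_m(M(\lambda_0))\qquad\text{and}\qquad \sigma_{(d'm+\sum_{i=1}^m d_i)}(T_{d'})\le\sigma_m(M_{\underline{d}}).$$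
   Context: Space: $\mathbb{C}[\lambda]^{m\times(m+n)}_{\underline{d}}$ is the linear space of $m\times(m+n)$ complex polynomial matrices $M(\lambda)$ whose $i$th row has the form $R_i(\lambda)=R_{i,0}+R_{i,1}\lambda+\cdots+R_{i,d_i}\lambda^{d_i}$ with $R_{i,j}\in\mathbb{C}^{1\times(m+n)}$, $i=1,\ldots,m$. The leading row-wise coefficient matrix of $M(\lambda)$ is the $m\times(m+n)$ constant matrix $M_{\underline{d}}$ whose $i$th row is $R_{i,d_i}$. Trimmed Sylvester matrices: put $d=\max_i d_i$ and write $M(\lambda)=M_0+M_1\lambda+\cdots+M_d\lambda^d$. For $k\ge1$, the $k$th Sylvester matrix $S_k(M)\in\mathbb{C}^{(k+d)m\times k(m+n)}$ is the block matrix with $k+d$ block rows (indexed $0,\ldots,k+d-1$) and $k$ block columns (indexed $0,\ldots,k-1$) whose $(p,q)$ block is $M_{p-q}$ if $0\le p-q\le d$ and $0$ otherwise. The $k$th trimmed Sylvester matrix $T_k(M)\in\mathbb{C}^{(km+\sum_{i=1}^m d_i)\times k(m+n)}$ is obtained from $S_k(M)$ by deleting, for every $i=1,\ldots,m$, the $i$th row of each of the last $d-d_i$ block rows (these rows are always zero), keeping the order of the remaining rows. Minimal bases and indices: a minimal basis of a subspace $\mathcal V\subseteq\mathbb{C}(\lambda)^{q}$ is a basis of $\mathcal V$ consisting of polynomial vectors with minimal sum of degrees among all polynomial bases of $\mathcal V$; the ordered list of degrees of the vectors in any minimal basis is the same, and these degrees are the minimal indices of $\mathcal V$. A polynomial matrix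 with more columns than rows is called a minimal basis if its rows form a minimal basis of the rational subspace they span. The right minimal indices of $M(\lambda)$ are the minimal indices of its right null space over $\mathbb{C}(\lambda)$. (Under the stated hypotheses $d'>0$.) Notation: $\sigma_1(A)\ge\cdots\ge\sigma_{\min\{p,q\}}(A)$ are the singular values of $A\in\mathbb{C}^{p\times q}$. *)

theory Defs
  imports
    "HOL-Computational_Algebra.Polynomial_Factorial"
    "Jordan_Normal_Form.Schur_Decomposition"
    "Jordan_Normal_Form.Matrix_Kernel"
    "Jordan_Normal_Form.DL_Rank"
    "Jordan_Normal_Form.DL_Submatrix"
begin

text \<open>
  Row and column indices are zero-based throughout, as in the matrix library.  A row degree list
  \<open>(d\<^sub>1, \<dots>, d\<^sub>m)\<close> is a list \<open>ds\<close> of length \<open>m\<close>.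
\<close>

section \<open>Singular values\<close>

text \<open>
  The singular values of a \<open>p \<times> q\<close> matrix \<open>A\<close> are the square roots of the \<open>min p q\<close> largest
  eigenvalues (with algebraic multiplicity) of the positive semidefinite matrix \<open>A A\<^sup>*\<close>, in
  nonincreasing order.  The list below has length \<open>p\<close>: if \<open>p > q\<close>, its entries beyond
  position \<open>min p q\<close> are zero.
\<close>

definition singular_values :: "complex mat \<Rightarrow> real list" where
  "singular_values A =
     rev (sorted_list_of_multiset
       (image_mset (\<lambda>z. sqrt (Re z)) (proots (char_poly (A * mat_adjoint A)))))"

text \<open>\<open>singular_value k A\<close> is \<open>\<sigma>\<^sub>k(A)\<close>, with \<open>k\<close> counted from 1.\<close>

definition singular_value :: "nat \<Rightarrow> complex mat \<Rightarrow> real" where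
  "singular_value k A = singular_values A ! (k - 1)"

section \<open>Polynomial matrices with prescribed row degree bounds\<close>

definition poly_mats :: "nat \<Rightarrow> nat \<Rightarrow> nat list \<Rightarrow> complex poly mat set" where
  "poly_mats m q ds =
     {M \<in> carrier_mat m q. \<forall>i<m. \<forall>j<q. degree (M $$ (i, j)) \<le> ds ! i}"

definition eval_poly_mat :: "complex poly mat \<Rightarrow> complex \<Rightarrow> complex mat" where
  "eval_poly_mat M z = map_mat (\<lambda>p. poly p z) M"

text \<open>The degrees are the prescribed \<open>ds ! i\<close>, not the actual degrees of the rows, so a row of the
  leading coefficient matrix may vanish.\<close>

definition leading_row_coeff_mat :: "nat list \<Rightarrow> complex poly mat \<Rightarrow> complex mat" where
  "leading_row_coeff_mat ds M =
     mat (dim_row M) (dim_col M) (\<lambda>(i, j). coeff (M $$ (i, j)) (ds ! i))"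

section \<open>Sylvester matrices\<close>

text \<open>
  Row \<open>r\<close> of \<open>S\<^sub>k(M)\<close> is row \<open>r mod m\<close> of block row \<open>r div m\<close>, and similarly for columns.
\<close>

definition sylvester_mat :: "nat list \<Rightarrow> nat \<Rightarrow> complex poly mat \<Rightarrow> complex mat" where
  "sylvester_mat ds k M =
     (let m = dim_row M; q = dim_col M; d = Max (set ds)
      in mat ((k + d) * m) (k * q) (\<lambda>(r, c).
           let a = r div m; b = c div q
           in if b \<le> a \<and> a - b \<le> d then coeff (M $$ (r mod m, c mod q)) (a - b) else 0))"

text \<open>
  Deleting row \<open>i\<close> from the last \<open>d - d\<^sub>i\<close> of the \<open>k + d\<close> block rows means keeping it exactly in
  the block rows with index below \<open>(k + d) - (d - d\<^sub>i)\<close>.  The constant \<open>submatrix\<close> preserves the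
  order of the rows kept.
\<close>

definition trimmed_sylvester_mat :: "nat list \<Rightarrow> nat \<Rightarrow> complex poly mat \<Rightarrow> complex mat" where
  "trimmed_sylvester_mat ds k M =
     (let m = dim_row M; d = Max (set ds)
      in submatrix (sylvester_mat ds k M) {r. r div m < (k + d) - (d - ds ! (r mod m))} UNIV)"

section \<open>Minimal bases and minimal indices\<close>

definition poly_vec_degree :: "complex poly vec \<Rightarrow> nat" where
  "poly_vec_degree v = Max ((\<lambda>i. degree (v $ i)) ` {..<dim_vec v})"

text \<open>
  In the following, \<open>W\<close> is a subspace of \<open>\<complex>(\<lambda>)\<^sup>q\<close>, the space of vectors of dimension \<open>q\<close> over the
  field of fractions of \<open>\<complex>[\<lambda>]\<close>.
\<close>

definition poly_basis ::
    "nat \<Rightarrow> complex poly fract vec set \<Rightarrow> complex poly vec list \<Rightarrow> bool" where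
  "poly_basis q W bs \<longleftrightarrow>
     set bs \<subseteq> carrier_vec q \<and> distinct bs \<and>
     vectorspace.basis class_ring (module_vec TYPE(complex poly fract) q \<lparr>carrier := W\<rparr>)
       (map_vec to_fract ` set bs)"

definition minimal_basis ::
    "nat \<Rightarrow> complex poly fract vec set \<Rightarrow> complex poly vec list \<Rightarrow> bool" where
  "minimal_basis q W bs \<longleftrightarrow>
     poly_basis q W bs \<and>
     (\<forall>cs. poly_basis q W cs \<longrightarrow>
        sum_list (map poly_vec_degree bs) \<le> sum_list (map poly_vec_degree cs))"

text \<open>
  Every subspace has a minimal basis, and the ordered list of degrees does not depend on which
  one is chosen.
\<close>

definition minimal_indices :: "nat \<Rightarrow> complex poly fract vec set \<Rightarrow> nat list" where
  "minimal_indices q W = sort (map poly_vec_degree (SOME bs. minimal_basis q W bs))"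

definition minimal_basis_mat :: "complex poly mat \<Rightarrow> bool" where
  "minimal_basis_mat M \<longleftrightarrow>
     dim_row M < dim_col M \<and>
     minimal_basis (dim_col M)
       (vec_space.row_space (dim_col M) (map_mat to_fract M)) (rows M)"

definition right_minimal_indices :: "complex poly mat \<Rightarrow> nat list" where
  "right_minimal_indices M = minimal_indices (dim_col M) (mat_kernel (map_mat to_fract M))"

end

theory Submission
  imports Defs "HOL-Analysis.Function_Topology" "HOL-Analysis.Topology_Euclidean_Space"
begin

text \<open>
  The last singular value of a matrix with \<open>p\<close> rows, if it is taken to be \<open>0\<close> when there are fewer than
  \<open>p\<close> columns, is the minimum of \<open>\<parallel>x A\<parallel> / \<parallel>x\<parallel>\<close> over nonzero rows \<open>x\<close>.  Index the rows of the
  trimmed Sylvester matrix by pairs \<open>(a, i)\<close> with \<open>i < m\<close> and \<open>a < k + d\<^sub>i\<close>.  If \<open>w\<close> is a minimizer for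
  \<open>M(z)\<close>, the row \<open>x = (z\<^sup>a w\<^sub>i)\<close> is mapped to the blocks \<open>z\<^sup>b w M(z)\<close>, \<open>b < k\<close>, while \<open>\<parallel>x\<parallel>\<^sup>2\<close> is at least
  \<open>\<parallel>w\<parallel>\<^sup>2\<close> times \<open>\<Sum>b<k. \<bar>z\<^sup>b\<bar>\<^sup>2\<close>.  For the leading coefficient matrix, the corresponding test row has
  the entry \<open>w\<^sub>i\<close> at \<open>a = k + d\<^sub>i - 1\<close> and zeros elsewhere.
\<close>

section \<open>Rows as functions and their squared norms\<close>

text \<open>A row is a function on all of \<open>nat\<close>, with its length \<open>p\<close>
  passed separately. Rows of every length thus share one type, whose product topology supplies the
  compactness behind the minimizer.\<close>

definition row_mult :: "nat \<Rightarrow> (nat \<Rightarrow> nat \<Rightarrow> complex) \<Rightarrow> (nat \<Rightarrow> complex) \<Rightarrow> nat \<Rightarrow> complex" where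
  "row_mult p A x j = (\<Sum>i<p. x i * A i j)"

definition normsq :: "nat \<Rightarrow> (nat \<Rightarrow> complex) \<Rightarrow> real" where
  "normsq p x = (\<Sum>i<p. (cmod (x i))\<^sup>2)"

lemma normsq_nonneg: "0 \<le> normsq p x"
  by (simp add: normsq_def sum_nonneg)

lemma normsq_eq_0_iff: "normsq p x = 0 \<longleftrightarrow> (\<forall>i<p. x i = 0)"
  by (auto simp: normsq_def sum_nonneg_eq_0_iff)

lemma normsq_cong: "(\<And>i. i < p \<Longrightarrow> x i = y i) \<Longrightarrow> normsq p x = normsq p y"
  by (simp add: normsq_def)

lemma row_mult_cong: "(\<And>i. i < p \<Longrightarrow> x i = y i) \<Longrightarrow> row_mult p A x = row_mult p A y"
  by (simp add: row_mult_def fun_eq_iff)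

lemma normsq_scale: "normsq p (\<lambda>i. c * x i) = (cmod c)\<^sup>2 * normsq p x"
  by (simp add: normsq_def sum_distrib_left norm_mult power_mult_distrib)

lemma row_mult_scale: "row_mult p A (\<lambda>i. c * x i) = (\<lambda>j. c * row_mult p A x j)"
  by (simp add: row_mult_def sum_distrib_left fun_eq_iff mult.assoc)

lemma row_mult_add: "row_mult p A (\<lambda>i. x i + y i) = (\<lambda>j. row_mult p A x j + row_mult p A y j)"
  by (simp add: row_mult_def sum.distrib fun_eq_iff ring_distribs)

lemma normsq_add_scale:
  fixes e :: real
  shows "normsq p (\<lambda>i. x i + of_real e * y i)
     = normsq p x + 2 * e * Re (\<Sum>i<p. x i * cnj (y i)) + e\<^sup>2 * normsq p y"
proof -
  have "(cmod (u + of_real e * v))\<^sup>2 = (cmod u)\<^sup>2 + 2 * e * Re (u * cnj v) + e\<^sup>2 * (cmod v)\<^sup>2"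
    for u v :: complex
    unfolding cmod_power2 by (simp add: power2_eq_square algebra_simps)
  then show ?thesis
    by (simp add: normsq_def sum.distrib sum_distrib_left distrib_left)
qed

section \<open>Minimizing the Rayleigh quotient\<close>

text \<open>By Tychonoff the product of discs and singletons is compact, and the unit norm condition
  is closed because it involves only finitely many coordinates. Fixing the coordinates from
  \<open>p\<close> on to 0 keeps them in a compact set.\<close>

lemma compact_unit_sphere_fun:
  "compact ((\<Pi>\<^sub>E i\<in>UNIV. if i < p then cball 0 1 else {0}) \<inter> {x. normsq p x = 1})"
proof (rule compact_Int_closed)
  have "compactin (product_topology (\<lambda>i. euclidean) UNIV)
      (\<Pi>\<^sub>E i\<in>UNIV. if i < p then cball 0 1 else {0 :: complex})"
    unfolding compactin_PiE by auto
  then show "compact (\<Pi>\<^sub>E i\<in>UNIV. if i < p then cball 0 1 else {0 :: complex})"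
    by (simp add: euclidean_product_topology)
next
  have "closed (normsq p -` {1})"
    unfolding normsq_def
    by (intro continuous_closed_vimage closed_singleton continuous_intros)
       (auto intro!: continuous_intros simp: continuous_on_eq_continuous_at[symmetric])
  then show "closed {x. normsq p x = 1}"
    by (simp add: vimage_def)
qed

text \<open>A continuous function attains its minimum on the compact unit sphere. Both sides of the
  inequality are homogeneous of degree two in \<open>x\<close>, so rescaling carries the bound from
  unit rows to all rows.\<close>

lemma Rayleigh_minimizer:
  assumes "p > 0"
  obtains w where "normsq p w = 1"
    "\<And>x. normsq q (row_mult p A w) * normsq p x \<le> normsq q (row_mult p A x)"
proof -
  define K where "K = (\<Pi>\<^sub>E i\<in>UNIV. if i < p then cball 0 1 else {0}) \<inter> {x. normsq p x = 1}"
  have norm_mem: "(\<lambda>i. if i < p then of_real (1 / sqrt (normsq p x)) * x i else 0) \<in> K"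
    if "normsq p x \<noteq> 0" for x
  proof -
    have pos: "normsq p x > 0"
      using that normsq_nonneg[of p x] by linarith
    have "normsq p (\<lambda>i. if i < p then of_real (1 / sqrt (normsq p x)) * x i else 0)
        = normsq p (\<lambda>i. of_real (1 / sqrt (normsq p x)) * x i)"
      by (rule normsq_cong) simp
    also have "\<dots> = 1"
      using pos by (simp only: normsq_scale norm_of_real) (simp add: power_divide)
    finally have 1: "normsq p (\<lambda>i. if i < p then of_real (1 / sqrt (normsq p x)) * x i else 0) = 1" .
    have "cmod (of_real (1 / sqrt (normsq p x)) * x i) \<le> 1" if "i < p" for i
    proof -
      have "(cmod (x i))\<^sup>2 \<le> normsq p x"
        unfolding normsq_def using that by (intro member_le_sum) auto
      then have "cmod (x i) \<le> sqrt (normsq p x)"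
        by (rule real_le_rsqrt)
      then show ?thesis
        using pos by (simp add: norm_mult norm_divide)
    qed
    then show ?thesis
      unfolding K_def using 1 by (auto simp: PiE_def)
  qed
  have "normsq p (\<lambda>i. 1) \<noteq> 0"
    using assms by (simp add: normsq_def)
  then have "K \<noteq> {}"
    using norm_mem by blast
  moreover have "compact K"
    unfolding K_def by (rule compact_unit_sphere_fun)
  moreover have "continuous_on K (\<lambda>x. normsq q (row_mult p A x))"
    unfolding normsq_def row_mult_def
    by (intro continuous_intros) (auto intro: continuous_on_subset[OF continuous_on_product_coordinates])
  ultimately obtain w where w: "w \<in> K"
    and min: "\<And>y. y \<in> K \<Longrightarrow> normsq q (row_mult p A w) \<le> normsq q (row_mult p A y)"
    using continuous_attains_inf by metis
  have "normsq q (row_mult p A w) * normsq p x \<le> normsq q (row_mult p A x)" for x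
  proof (cases "normsq p x = 0")
    case True
    then show ?thesis by (simp add: normsq_nonneg)
  next
    case False
    then have pos: "normsq p x > 0"
      using normsq_nonneg[of p x] by linarith
    have "normsq q (row_mult p A w)
        \<le> normsq q (row_mult p A (\<lambda>i. if i < p then of_real (1 / sqrt (normsq p x)) * x i else 0))"
      by (rule min[OF norm_mem[OF False]])
    also have "row_mult p A (\<lambda>i. if i < p then of_real (1 / sqrt (normsq p x)) * x i else 0)
        = row_mult p A (\<lambda>i. of_real (1 / sqrt (normsq p x)) * x i)"
      by (rule row_mult_cong) simp
    also have "normsq q (row_mult p A (\<lambda>i. of_real (1 / sqrt (normsq p x)) * x i))
        = normsq q (row_mult p A x) / normsq p x"
      using pos by (simp only: row_mult_scale normsq_scale norm_of_real) (simp add: power_divide)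
    finally show ?thesis
      using pos by (simp add: field_simps)
  qed
  with w that show thesis
    unfolding K_def by blast
qed

text \<open>For small \<open>e\<close> of sign opposite to \<open>b\<close> the linear term would
  win and make the expression negative.\<close>

lemma quadratic_nonneg_linear_coeff:
  fixes b c :: real
  assumes "\<And>e. 0 \<le> 2 * e * b + e\<^sup>2 * c"
  shows "b = 0"
proof (rule ccontr)
  assume b: "b \<noteq> 0"
  \<comment> \<open>With this choice the quadratic term is at most \<open>- e * b\<close>, half the
    size of the linear term; the added 1 keeps the denominator positive when
    \<open>c = 0\<close>.\<close>
  define e where "e = - b / (\<bar>c\<bar> + 1)"
  have "e\<^sup>2 * c \<le> e\<^sup>2 * (\<bar>c\<bar> + 1)"
    by (intro mult_left_mono) auto
  also have "\<dots> = - e * b"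
    by (simp add: e_def power2_eq_square)
  finally have "0 \<le> e * b"
    using assms[of e] by linarith
  moreover have "e * b < 0"
    using b by (simp add: e_def divide_neg_pos mult_pos_pos flip: power2_eq_square)
  ultimately show False by simp
qed

text \<open>The first variation of the Rayleigh quotient at a minimizer vanishes, tested in the direction
  of the residual itself.\<close>

lemma Rayleigh_stationary:
  assumes t: "\<And>x. t * normsq p x \<le> normsq q (row_mult p A x)"
    and w: "normsq q (row_mult p A w) = t * normsq p w"
    and "i < p"
  shows "(\<Sum>j<q. row_mult p A w j * cnj (A i j)) = of_real t * w i"
proof -
  have re: "Re u - t * Re v = r" if "u - of_real t * v = of_real r" for u v and r :: real
    using arg_cong[OF that, of Re] by simp
  define h where "h i = (\<Sum>j<q. row_mult p A w j * cnj (A i j))" for i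
  define g where "g i = h i - of_real t * w i" for i
  have "(\<Sum>j<q. row_mult p A w j * cnj (row_mult p A g j))
      = (\<Sum>j<q. \<Sum>i<p. row_mult p A w j * cnj (A i j) * cnj (g i))"
    by (simp add: row_mult_def[of p A g] sum_distrib_left mult_ac)
  also have "\<dots> = (\<Sum>i<p. h i * cnj (g i))"
    by (subst sum.swap) (simp add: h_def sum_distrib_right)
  finally have "(\<Sum>j<q. row_mult p A w j * cnj (row_mult p A g j)) - of_real t * (\<Sum>i<p. w i * cnj (g i))
      = (\<Sum>i<p. (h i - of_real t * w i) * cnj (g i))"
    by (simp add: sum_distrib_left sum_subtractf left_diff_distrib mult.assoc)
  also have "\<dots> = (\<Sum>i<p. g i * cnj (g i))"
    by (simp only: g_def)
  also have "\<dots> = of_real (normsq p g)"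
    by (simp add: normsq_def flip: complex_norm_square)
  finally have "Re (\<Sum>j<q. row_mult p A w j * cnj (row_mult p A g j)) - t * Re (\<Sum>i<p. w i * cnj (g i))
      = normsq p g"
    by (rule re)
  \<comment> \<open>This is the bound \<open>t\<close> at the row \<open>w + e g\<close>. The terms
    free of \<open>e\<close> cancel because \<open>w\<close> attains equality, and the linear
    coefficient was just identified as \<open>normsq p g\<close>.\<close>
  moreover have "0 \<le> 2 * e * (Re (\<Sum>j<q. row_mult p A w j * cnj (row_mult p A g j))
        - t * Re (\<Sum>i<p. w i * cnj (g i)))
      + e\<^sup>2 * (normsq q (row_mult p A g) - t * normsq p g)" for e
    using t[of "\<lambda>i. w i + of_real e * g i"] w
    by (simp add: row_mult_add row_mult_scale normsq_add_scale algebra_simps)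
  ultimately have "normsq p g = 0"
    using quadratic_nonneg_linear_coeff by metis
  then have "g i = 0"
    using assms(3) by (simp add: normsq_eq_0_iff)
  then show ?thesis
    by (simp add: g_def h_def)
qed

section \<open>The last singular value as a Rayleigh minimum\<close>

text \<open>Eigenvectors are columns while the variational argument uses rows. Taking adjoints turns
  \<open>A A^* v\<close> into \<open>v^* A A^*\<close>, which is where the conjugations come
  from.\<close>

lemma gram_mult_vec_index:
  assumes A: "A \<in> carrier_mat p q" and "v \<in> carrier_vec p" and "i < p"
  shows "(A * mat_adjoint A *\<^sub>v v) $ i
     = cnj (\<Sum>j<q. row_mult p (\<lambda>i j. A $$ (i, j)) (\<lambda>i. cnj (v $ i)) j * cnj (A $$ (i, j)))"
proof -
  have "(A * mat_adjoint A *\<^sub>v v) $ i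
      = (\<Sum>l<p. (\<Sum>j<q. A $$ (i, j) * cnj (A $$ (l, j))) * v $ l)"
    using assms by (simp add: mat_adjoint_def scalar_prod_def atLeast0LessThan mat_of_rows_def)
  also have "\<dots> = (\<Sum>j<q. \<Sum>l<p. A $$ (i, j) * cnj (A $$ (l, j)) * v $ l)"
    by (subst sum.swap) (simp add: sum_distrib_right)
  also have "\<dots> = cnj (\<Sum>j<q. row_mult p (\<lambda>i j. A $$ (i, j)) (\<lambda>i. cnj (v $ i)) j * cnj (A $$ (i, j)))"
    by (simp add: row_mult_def sum_distrib_left sum_distrib_right mult_ac)
  finally show ?thesis .
qed

text \<open>The characteristic polynomial of \<open>A A^*\<close> has degree \<open>p\<close> and
  splits over the complex numbers, so the list has exactly \<open>p\<close> entries. Its last entry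
  is the first one of the increasing list, hence the least.\<close>

lemma smallest_singular_value:
  assumes A: "A \<in> carrier_mat p q" and "p > 0"
  shows "is_arg_min id (\<lambda>s. \<exists>z. eigenvalue (A * mat_adjoint A) z \<and> s = sqrt (Re z))
    (singular_value p A)"
proof -
  define H where "H = A * mat_adjoint A"
  have H: "H \<in> carrier_mat p p"
    using A by (auto simp: H_def mat_adjoint_def)
  define S where "S = image_mset (\<lambda>z. sqrt (Re z)) (proots (char_poly H))"
  have size: "size S = p"
    using degree_monic_char_poly[OF H] by (simp add: S_def size_proots_complex)
  have "char_poly H \<noteq> 0"
    using degree_monic_char_poly[OF H] by auto
  then have set: "set_mset S = {s. \<exists>z. eigenvalue H z \<and> s = sqrt (Re z)}"
    by (auto simp: S_def eigenvalue_root_char_poly[OF H])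
  have len: "length (sorted_list_of_multiset S) = p"
    using size by (metis mset_sorted_list_of_multiset size_mset)
  then have "singular_value p A = sorted_list_of_multiset S ! 0"
    using \<open>p > 0\<close> by (simp add: singular_value_def singular_values_def S_def H_def rev_nth)
  moreover have "sorted_list_of_multiset S ! 0 \<in> set_mset S"
    using len \<open>p > 0\<close> by (metis nth_mem set_sorted_list_of_multiset)
  moreover have "sorted_list_of_multiset S ! 0 \<le> s" if s: "s \<in> set_mset S" for s
  proof -
    obtain i where "i < p" "s = sorted_list_of_multiset S ! i"
      using s len by (metis in_set_conv_nth set_sorted_list_of_multiset)
    then show ?thesis
      using len by (simp add: sorted_nth_mono)
  qed
  ultimately show ?thesis
    unfolding H_def[symmetric] is_arg_min_linorder using set by auto
qed

text \<open>The minimum \<open>t\<close> of the Rayleigh quotient is the least eigenvalue of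
  \<open>A A^*\<close>. Stationarity makes the minimizer an eigenvector for \<open>t\<close>;
  conversely, an eigenvector for \<open>z\<close> gives a row at which the quotient equals
  \<open>Re z\<close>, so \<open>t\<close> is at most \<open>Re z\<close>. Hence
  \<open>s = sqrt t\<close>.\<close>

lemma singular_value_variational:
  assumes A: "A \<in> carrier_mat p q" and "p > 0"
  defines "a \<equiv> \<lambda>i j. A $$ (i, j)" and "s \<equiv> singular_value p A"
  shows singular_value_nonneg: "0 \<le> s"
    and singular_value_le: "\<And>x. s\<^sup>2 * normsq p x \<le> normsq q (row_mult p a x)"
    and singular_value_attained: "\<exists>w. normsq p w = 1 \<and> normsq q (row_mult p a w) = s\<^sup>2"
proof -
  define H where "H = A * mat_adjoint A"
  have H: "H \<in> carrier_mat p p"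
    using A by (auto simp: H_def mat_adjoint_def)
  have gram: "(H *\<^sub>v v) $ i = cnj (\<Sum>j<q. row_mult p a (\<lambda>i. cnj (v $ i)) j * cnj (a i j))"
    if "v \<in> carrier_vec p" "i < p" for v i
    unfolding a_def H_def by (rule gram_mult_vec_index[OF A that])
  obtain w where w: "normsq p w = 1"
    and min: "\<And>x. normsq q (row_mult p a w) * normsq p x \<le> normsq q (row_mult p a x)"
    using Rayleigh_minimizer[OF \<open>p > 0\<close>] by metis
  define t where "t = normsq q (row_mult p a w)"
  have t: "0 \<le> t"
    by (simp add: t_def normsq_nonneg)
  have stat: "(\<Sum>j<q. row_mult p a w j * cnj (a i j)) = of_real t * w i" if "i < p" for i
    using min w that by (intro Rayleigh_stationary) (simp_all add: t_def)
  define v where "v = Matrix.vec p (\<lambda>i. cnj (w i))"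
  have v: "v \<in> carrier_vec p"
    by (simp add: v_def)
  have row_mult_v: "row_mult p a (\<lambda>i. cnj (v $ i)) = row_mult p a w"
    by (rule row_mult_cong) (simp add: v_def)
  have "(H *\<^sub>v v) $ i = of_real t * v $ i" if "i < p" for i
  proof -
    have "(H *\<^sub>v v) $ i = cnj (of_real t * w i)"
      using gram[OF v that] unfolding row_mult_v stat[OF that] .
    then show ?thesis
      using that by (simp add: v_def)
  qed
  then have "H *\<^sub>v v = of_real t \<cdot>\<^sub>v v"
    using H by (intro eq_vecI) (auto simp: v_def)
  moreover have "v \<noteq> 0\<^sub>v p"
  proof
    assume "v = 0\<^sub>v p"
    then have "v $ i = 0" if "i < p" for i
      using that by simp
    then have "\<forall>i<p. w i = 0"
      by (simp add: v_def)
    then show False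
      using w normsq_eq_0_iff[of p w] by simp
  qed
  ultimately have ev: "eigenvalue H (of_real t)"
    using H unfolding eigenvalue_def eigenvector_def by (auto simp: v_def intro!: exI[of _ v])
  have lower: "t \<le> Re z" if z: "eigenvalue H z" for z
  proof -
    obtain u where u: "u \<in> carrier_vec p" "u \<noteq> 0\<^sub>v p" "H *\<^sub>v u = z \<cdot>\<^sub>v u"
      using z H unfolding eigenvalue_def eigenvector_def by auto
    have re: "r = Re z * r'" if "of_real r = cnj z * of_real r'" for r r' :: real
      using arg_cong[OF that, of Re] by simp
    define x where "x i = cnj (u $ i)" for i
    have eq: "(\<Sum>j<q. row_mult p a x j * cnj (a i j)) = cnj z * x i" if "i < p" for i
    proof -
      have "cnj (\<Sum>j<q. row_mult p a x j * cnj (a i j)) = z * u $ i"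
        using gram[OF u(1) that, folded x_def] u(1,3) that by (simp del: cnj_sum)
      then have "cnj (cnj (\<Sum>j<q. row_mult p a x j * cnj (a i j))) = cnj (z * u $ i)"
        by (rule arg_cong)
      then show ?thesis
        by (simp only: complex_cnj_cnj complex_cnj_mult x_def)
    qed
    \<comment> \<open>Pairing the eigenvector equation with \<open>x\<close> itself expresses the
      squared norm of the image through \<open>z\<close>; comparing real parts then leaves
      \<open>Re z\<close>.\<close>
    have "of_real (normsq q (row_mult p a x)) = (\<Sum>j<q. row_mult p a x j * cnj (row_mult p a x j))"
      by (simp add: normsq_def flip: complex_norm_square)
    also have "\<dots> = (\<Sum>j<q. \<Sum>i<p. row_mult p a x j * cnj (a i j) * cnj (x i))"
      by (rule sum.cong[OF refl]) (simp add: row_mult_def[of p a x] sum_distrib_left mult_ac)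
    also have "\<dots> = (\<Sum>i<p. (\<Sum>j<q. row_mult p a x j * cnj (a i j)) * cnj (x i))"
      by (subst sum.swap) (simp add: sum_distrib_right)
    also have "\<dots> = (\<Sum>i<p. cnj z * (x i * cnj (x i)))"
      by (simp add: eq mult.assoc)
    also have "\<dots> = cnj z * of_real (normsq p x)"
      by (simp add: normsq_def sum_distrib_left flip: complex_norm_square)
    finally have "normsq q (row_mult p a x) = Re z * normsq p x"
      using re by blast
    moreover have "normsq p x > 0"
    proof -
      have "\<exists>i<p. u $ i \<noteq> 0"
        using u(1,2) by (metis carrier_vecD eq_vecI index_zero_vec)
      then have "normsq p x \<noteq> 0"
        by (auto simp: normsq_eq_0_iff x_def)
      then show ?thesis
        using normsq_nonneg[of p x] by linarith
    qed
    ultimately show ?thesis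
      using min[of x] by (simp add: t_def)
  qed
  have "s = sqrt t"
  proof (rule antisym)
    note arg = smallest_singular_value[OF A \<open>p > 0\<close>, folded H_def s_def, unfolded is_arg_min_linorder]
    show "s \<le> sqrt t"
      using arg ev by (metis Re_complex_of_real id_apply)
    show "sqrt t \<le> s"
      using arg lower by auto
  qed
  then have s2: "s\<^sup>2 = t" and "0 \<le> s"
    using t by simp_all
  show "0 \<le> s" by fact
  show "s\<^sup>2 * normsq p x \<le> normsq q (row_mult p a x)" for x
    using min s2 by (simp add: t_def)
  show "\<exists>w. normsq p w = 1 \<and> normsq q (row_mult p a w) = s\<^sup>2"
    using w s2 by (auto simp: t_def)
qed

section \<open>Indexing the trimmed Sylvester matrix\<close>

text \<open>On the finite set \<open>J\<close>, \<open>pick\<close> is strictly increasing with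
  values in \<open>J\<close>, so counting gives surjectivity. Sums over rows of a submatrix thereby
  become sums over the rows kept.\<close>

lemma bij_betw_pick:
  "bij_betw (pick I) {..<card {i. i < n \<and> i \<in> I}} {i. i < n \<and> i \<in> I}"
proof -
  define J where "J = {i. i < n \<and> i \<in> I}"
  have fin: "finite J"
    by (simp add: J_def)
  have inj: "inj_on (pick J) {..<card J}"
    by (rule linorder_inj_onI') (metis lessThan_iff less_irrefl pick_mono_le)
  moreover have "pick J ` {..<card J} \<subseteq> J"
    by (auto intro: pick_in_set_le)
  ultimately have "bij_betw (pick J) {..<card J} J"
    using fin by (simp add: bij_betw_def card_image card_subset_eq)
  \<comment> \<open>Discarding the elements from \<open>n\<close> on does not affect the first
    \<open>card J\<close> picks.\<close>
  moreover have "pick J i = pick I i" if "i \<in> {..<card J}" for i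
    using that pick_reduce_set[of i n I] by (simp add: J_def)
  ultimately show ?thesis
    unfolding J_def[symmetric] using bij_betw_cong by blast
qed

text \<open>Division with remainder matches \<open>r\<close> with the pair
  \<open>(r div m, r mod m)\<close>; the bound \<open>K\<close> on the heights keeps
  \<open>a * m + i\<close> in range. It serves for the trimmed rows, with height depending on
  \<open>i\<close>, and for the columns, with constant height.\<close>

lemma sum_blocks:
  fixes f :: "nat \<Rightarrow> 'a :: comm_monoid_add"
  assumes "\<And>i. i < m \<Longrightarrow> h i \<le> K"
  shows "sum f {r. r < K * m \<and> r div m < h (r mod m)} = (\<Sum>i<m. \<Sum>a<h i. f (a * m + i))"
proof -
  have bound: "a * m + i < K * m" if "a < h i" "i < m" for a i
  proof -
    have "a * m + i < Suc a * m" using that by simp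
    also have "\<dots> \<le> K * m" using that assms[of i] by (intro mult_right_mono) auto
    finally show ?thesis .
  qed
  have mod: "r mod m < m" if "r < K * m" for r
    using that by (cases "m = 0") auto
  have "(\<Sum>i<m. \<Sum>a<h i. f (a * m + i)) = (\<Sum>(i, a)\<in>(SIGMA i:{..<m}. {..<h i}). f (a * m + i))"
    by (rule sum.Sigma) auto
  also have "\<dots> = sum f {r. r < K * m \<and> r div m < h (r mod m)}"
    by (rule sum.reindex_bij_witness[where j = "\<lambda>(i, a). a * m + i" and i = "\<lambda>r. (r mod m, r div m)"])
       (use bound mod in \<open>auto simp: mult.commute[of _ m]\<close>)
  finally show ?thesis by simp
qed

text \<open>This is the variational bound for the test row whose entry at row \<open>i\<close> of
  block row \<open>a\<close> is \<open>f a i\<close>. Block \<open>(a, b)\<close> of the Sylvester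
  matrix is the coefficient of index \<open>a - b\<close>, so block column \<open>b\<close> sees the
  entries \<open>f (b + t) i\<close> against the coefficients of index \<open>t\<close>. The choice
  of \<open>f\<close> is left open for the two applications.\<close>

lemma trimmed_sylvester_singular_value_le:
  fixes M :: "complex poly mat" and f :: "nat \<Rightarrow> nat \<Rightarrow> complex"
  assumes ds: "length ds = m" and M: "M \<in> poly_mats m q ds" and pos: "k * m + sum_list ds > 0"
  defines "N \<equiv> k * m + sum_list ds" and "T \<equiv> trimmed_sylvester_mat ds k M"
  shows "0 \<le> singular_value N T"
    and "(singular_value N T)\<^sup>2 * (\<Sum>i<m. \<Sum>a<k + ds ! i. (cmod (f a i))\<^sup>2)
      \<le> (\<Sum>b<k. \<Sum>j<q. (cmod (\<Sum>i<m. \<Sum>t\<le>ds ! i. f (b + t) i * coeff (M $$ (i, j)) t))\<^sup>2)"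
proof -
  define d where "d = Max (set ds)"
  define R where "R = {r. r div m < (k + d) - (d - ds ! (r mod m))}"
  define J where "J = {r. r < (k + d) * m \<and> r \<in> R}"
  define S where "S = sylvester_mat ds k M"
  have dM: "dim_row M = m" "dim_col M = q"
    and deg: "\<And>i j. i < m \<Longrightarrow> j < q \<Longrightarrow> degree (M $$ (i, j)) \<le> ds ! i"
    using M by (auto simp: poly_mats_def)
  have le_d: "ds ! i \<le> d" if "i < m" for i
    using that ds by (auto simp: d_def)
  \<comment> \<open>Since \<open>ds ! i\<close> is at most \<open>d\<close>, the truncated
    difference in \<open>R\<close> equals \<open>k + ds ! i\<close>. Summing the constant 1 will
    give the row count \<open>N\<close>.\<close>
  have sumJ: "sum h J = (\<Sum>i<m. \<Sum>a<k + ds ! i. h (a * m + i))"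
    for h :: "nat \<Rightarrow> 'b :: comm_monoid_add"
    unfolding J_def R_def mem_Collect_eq
    by (subst sum_blocks) (auto simp: le_d intro!: sum.cong)
  have dimS: "dim_row S = (k + d) * m" "dim_col S = k * q"
    by (simp_all add: S_def sylvester_mat_def Let_def dM d_def)
  have T: "T = submatrix S R UNIV"
    by (simp add: T_def trimmed_sylvester_mat_def S_def R_def Let_def dM d_def)
  have "sum_list ds = (\<Sum>i<m. ds ! i)"
    by (simp add: sum_list_sum_nth atLeast0LessThan ds)
  then have cardJ: "card J = N"
    using sumJ[of "\<lambda>_. 1::nat"] by (simp add: N_def sum.distrib)
  have T_carrier: "T \<in> carrier_mat N (k * q)"
  proof (rule carrier_matI)
    show "dim_row T = N"
      unfolding cardJ[symmetric] by (simp only: T dim_submatrix dimS J_def)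
    show "dim_col T = k * q"
      by (simp add: T dim_submatrix dimS)
  qed
  have T_index: "T $$ (i, c) = S $$ (pick R i, c)" if "i < N" "c < k * q" for i c
    using that submatrix_index[of i S R c UNIV] by (simp add: T dimS cardJ pick_UNIV flip: J_def)
  have sum_pick: "(\<Sum>i<N. h (pick R i)) = sum h J" for h :: "nat \<Rightarrow> 'b :: comm_monoid_add"
    using bij_betw_pick[of R "(k + d) * m"] unfolding J_def[symmetric] cardJ
    by (rule sum.reindex_bij_betw)
  \<comment> \<open>\<open>X\<close> lives on the rows of the untrimmed matrix; \<open>x\<close>
    reads it off at the rows kept.\<close>
  define X where "X r = f (r div m) (r mod m)" for r
  define x where "x i = X (pick R i)" for i
  have "normsq N x = (\<Sum>r\<in>J. (cmod (X r))\<^sup>2)"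
    unfolding normsq_def x_def by (rule sum_pick)
  also have "\<dots> = (\<Sum>i<m. \<Sum>a<k + ds ! i. (cmod (f a i))\<^sup>2)"
    by (simp add: sumJ X_def)
  finally have norm_x: "normsq N x = \<dots>" .
  have row_mult_x: "row_mult N (\<lambda>i j. T $$ (i, j)) x (b * q + j)
      = (\<Sum>i<m. \<Sum>t\<le>ds ! i. f (b + t) i * coeff (M $$ (i, j)) t)" if b: "b < k" and j: "j < q" for b j
  proof -
    have "b * q + j < Suc b * q" using j by simp
    also have "\<dots> \<le> k * q" using b by (intro mult_right_mono) auto
    finally have c: "b * q + j < k * q" .
    have "row_mult N (\<lambda>i j. T $$ (i, j)) x (b * q + j) = (\<Sum>i<N. X (pick R i) * S $$ (pick R i, b * q + j))"
      using c by (simp add: row_mult_def x_def T_index)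
    also have "\<dots> = (\<Sum>r\<in>J. X r * S $$ (r, b * q + j))"
      by (rule sum_pick)
    also have "\<dots> = (\<Sum>i<m. \<Sum>a<k + ds ! i. X (a * m + i) * S $$ (a * m + i, b * q + j))"
      by (rule sumJ)
    also have "\<dots> = (\<Sum>i<m. \<Sum>t\<le>ds ! i. f (b + t) i * coeff (M $$ (i, j)) t)"
    proof (rule sum.cong[OF refl])
      fix i assume "i \<in> {..<m}"
      then have i: "i < m" by simp
      have Sval: "S $$ (a * m + i, b * q + j)
          = (if b \<le> a \<and> a - b \<le> d then coeff (M $$ (i, j)) (a - b) else 0)"
        if "a < k + ds ! i" for a
      proof -
        have "a * m + i < Suc a * m" using i by simp
        also have "\<dots> \<le> (k + d) * m" using that le_d[OF i] by (intro mult_right_mono) auto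
        finally have "a * m + i < (k + d) * m" .
        then show ?thesis
          using c i j by (simp add: S_def sylvester_mat_def Let_def dM flip: d_def)
      qed
      have "(\<Sum>a<k + ds ! i. X (a * m + i) * S $$ (a * m + i, b * q + j))
          = (\<Sum>a<k + ds ! i. if b \<le> a \<and> a - b \<le> d then f a i * coeff (M $$ (i, j)) (a - b) else 0)"
        using i by (intro sum.cong refl) (simp add: Sval X_def)
      \<comment> \<open>Substitute \<open>a = b + t\<close>. As \<open>b < k\<close>, these indices
        stay below \<open>k + ds ! i\<close>, so trimming loses none of them; the remaining terms
        vanish by position or by the degree bound.\<close>
      also have "\<dots> = (\<Sum>a\<in>(+) b ` {..ds ! i}. f a i * coeff (M $$ (i, j)) (a - b))"
      proof (rule sum.mono_neutral_cong_right)
        show "(+) b ` {..ds ! i} \<subseteq> {..<k + ds ! i}"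
          using b by auto
        show "\<forall>a\<in>{..<k + ds ! i} - (+) b ` {..ds ! i}.
            (if b \<le> a \<and> a - b \<le> d then f a i * coeff (M $$ (i, j)) (a - b) else 0) = 0"
        proof
          fix a assume a: "a \<in> {..<k + ds ! i} - (+) b ` {..ds ! i}"
          have "ds ! i < a - b" if "b \<le> a"
          proof (rule ccontr)
            assume "\<not> ds ! i < a - b"
            then have "a \<in> (+) b ` {..ds ! i}"
              using that by (intro image_eqI[of _ _ "a - b"]) auto
            then show False using a by simp
          qed
          then show "(if b \<le> a \<and> a - b \<le> d then f a i * coeff (M $$ (i, j)) (a - b) else 0) = 0"
            using deg[OF i j] by (auto intro: coeff_eq_0)
        qed
      qed (use le_d[OF i] in auto)
      also have "\<dots> = (\<Sum>t\<le>ds ! i. f (b + t) i * coeff (M $$ (i, j)) t)"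
        by (subst sum.reindex) simp_all
      finally show "(\<Sum>a<k + ds ! i. X (a * m + i) * S $$ (a * m + i, b * q + j))
          = (\<Sum>t\<le>ds ! i. f (b + t) i * coeff (M $$ (i, j)) t)" .
    qed
    finally show ?thesis .
  qed
  have "normsq (k * q) (row_mult N (\<lambda>i j. T $$ (i, j)) x)
      = (\<Sum>b<k. \<Sum>j<q. (cmod (row_mult N (\<lambda>i j. T $$ (i, j)) x (b * q + j)))\<^sup>2)"
  proof (cases "q = 0")
    case False
    then have "{c. c < k * q \<and> c div q < k} = {..<k * q}"
      by (auto simp: less_mult_imp_div_less)
    then show ?thesis
      using sum_blocks[of q "\<lambda>_. k" k "\<lambda>c. (cmod (row_mult N (\<lambda>i j. T $$ (i, j)) x c))\<^sup>2"]
      by (subst sum.swap) (simp add: normsq_def)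
  qed (simp add: normsq_def)
  also have "\<dots> = (\<Sum>b<k. \<Sum>j<q. (cmod (\<Sum>i<m. \<Sum>t\<le>ds ! i. f (b + t) i * coeff (M $$ (i, j)) t))\<^sup>2)"
    by (simp add: row_mult_x)
  finally show "(singular_value N T)\<^sup>2 * (\<Sum>i<m. \<Sum>a<k + ds ! i. (cmod (f a i))\<^sup>2)
      \<le> (\<Sum>b<k. \<Sum>j<q. (cmod (\<Sum>i<m. \<Sum>t\<le>ds ! i. f (b + t) i * coeff (M $$ (i, j)) t))\<^sup>2)"
    using singular_value_le[OF T_carrier, of x] pos norm_x by (simp add: N_def)
  show "0 \<le> singular_value N T"
    using singular_value_nonneg[OF T_carrier] pos by (simp add: N_def)
qed

section \<open>The two test rows\<close>

text \<open>Shifting a geometric row by \<open>b\<close> multiplies it by \<open>z ^ b\<close>, so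
  the blocks of the image are multiples of one row and the common factor \<open>G\<close> can be
  cancelled.\<close>

lemma trimmed_sylvester_singular_value_le_eval:
  assumes ds: "length ds = m" and M: "M \<in> poly_mats m q ds" and "k > 0" "m > 0"
  shows "singular_value (k * m + sum_list ds) (trimmed_sylvester_mat ds k M)
    \<le> singular_value m (eval_poly_mat M z)"
proof -
  define s where "s = singular_value (k * m + sum_list ds) (trimmed_sylvester_mat ds k M)"
  have deg: "\<And>i j. i < m \<Longrightarrow> j < q \<Longrightarrow> degree (M $$ (i, j)) \<le> ds ! i"
    and cM: "M \<in> carrier_mat m q"
    using M by (auto simp: poly_mats_def)
  have A: "eval_poly_mat M z \<in> carrier_mat m q"
    using cM by (simp add: eval_poly_mat_def)
  define \<sigma> where "\<sigma> = singular_value m (eval_poly_mat M z)"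
  obtain w where w: "normsq m w = 1"
    and min: "normsq q (row_mult m (\<lambda>i j. eval_poly_mat M z $$ (i, j)) w) = \<sigma>\<^sup>2"
    using singular_value_attained[OF A \<open>m > 0\<close>] by (auto simp: \<sigma>_def)
  \<comment> \<open>The term for \<open>b = 0\<close> is 1 even at \<open>z = 0\<close>, so
    \<open>k > 0\<close> makes \<open>G\<close> positive.\<close>
  define G where "G = (\<Sum>b<k. (cmod z ^ b)\<^sup>2)"
  have "G > 0"
  proof -
    have "(cmod z ^ 0)\<^sup>2 \<le> G"
      unfolding G_def using \<open>k > 0\<close> by (intro member_le_sum) auto
    then show ?thesis by simp
  qed
  \<comment> \<open>The entries with \<open>a\<close> at least \<open>k\<close> only enlarge the
    norm of the test row and are dropped.\<close>
  have "G * normsq m w \<le> (\<Sum>i<m. \<Sum>a<k + ds ! i. (cmod (z ^ a * w i))\<^sup>2)"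
  proof -
    have "G * normsq m w = (\<Sum>i<m. \<Sum>a<k. (cmod (z ^ a * w i))\<^sup>2)"
      by (simp add: G_def normsq_def sum_distrib_left sum_distrib_right norm_mult norm_power
          power_mult_distrib)
    also have "\<dots> \<le> (\<Sum>i<m. \<Sum>a<k + ds ! i. (cmod (z ^ a * w i))\<^sup>2)"
      by (intro sum_mono sum_mono2) auto
    finally show ?thesis .
  qed
  then have "s\<^sup>2 * G \<le> s\<^sup>2 * (\<Sum>i<m. \<Sum>a<k + ds ! i. (cmod (z ^ a * w i))\<^sup>2)"
    using w by (intro mult_left_mono) auto
  also have "\<dots> \<le> (\<Sum>b<k. \<Sum>j<q. (cmod (\<Sum>i<m. \<Sum>t\<le>ds ! i. z ^ (b + t) * w i * coeff (M $$ (i, j)) t))\<^sup>2)"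
    using trimmed_sylvester_singular_value_le(2)[OF ds M, of k "\<lambda>a i. z ^ a * w i"] \<open>k > 0\<close> \<open>m > 0\<close>
    by (simp add: s_def)
  also have "\<dots> = (\<Sum>b<k. \<Sum>j<q. (cmod (z ^ b * row_mult m (\<lambda>i j. eval_poly_mat M z $$ (i, j)) w j))\<^sup>2)"
  proof (intro sum.cong refl)
    fix b j assume "j \<in> {..<q}"
    have "(\<Sum>t\<le>ds ! i. z ^ (b + t) * w i * coeff (M $$ (i, j)) t) = z ^ b * (w i * poly (M $$ (i, j)) z)"
      if "i < m" for i
    proof -
      have "poly (M $$ (i, j)) z = (\<Sum>t\<le>ds ! i. coeff (M $$ (i, j)) t * z ^ t)"
        unfolding poly_altdef using deg[of i j] that \<open>j \<in> {..<q}\<close>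
        by (intro sum.mono_neutral_left) (auto simp: coeff_eq_0)
      then show ?thesis
        by (simp add: sum_distrib_left power_add mult_ac)
    qed
    then have "(\<Sum>i<m. \<Sum>t\<le>ds ! i. z ^ (b + t) * w i * coeff (M $$ (i, j)) t)
        = z ^ b * row_mult m (\<lambda>i j. eval_poly_mat M z $$ (i, j)) w j"
      using cM \<open>j \<in> {..<q}\<close> by (simp add: row_mult_def sum_distrib_left eval_poly_mat_def)
    then show "(cmod (\<Sum>i<m. \<Sum>t\<le>ds ! i. z ^ (b + t) * w i * coeff (M $$ (i, j)) t))\<^sup>2
        = (cmod (z ^ b * row_mult m (\<lambda>i j. eval_poly_mat M z $$ (i, j)) w j))\<^sup>2"
      by simp
  qed
  also have "\<dots> = G * \<sigma>\<^sup>2"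
    by (simp add: G_def normsq_def norm_mult norm_power power_mult_distrib sum_distrib_right
        flip: sum_distrib_left min)
  finally have "s\<^sup>2 \<le> \<sigma>\<^sup>2"
    using \<open>G > 0\<close> by (simp add: mult.commute)
  then show ?thesis
    using singular_value_nonneg[OF A \<open>m > 0\<close>]
    unfolding s_def \<sigma>_def by (rule power2_le_imp_le)
qed

text \<open>The test row is supported on the last kept copy of each row \<open>i\<close>. Only the
  last block column meets this support, and it does so exactly in the leading coefficients.\<close>

lemma trimmed_sylvester_singular_value_le_leading:
  assumes ds: "length ds = m" and M: "M \<in> poly_mats m q ds" and "k > 0" "m > 0"
  shows "singular_value (k * m + sum_list ds) (trimmed_sylvester_mat ds k M)
    \<le> singular_value m (leading_row_coeff_mat ds M)"
proof -
  define s where "s = singular_value (k * m + sum_list ds) (trimmed_sylvester_mat ds k M)"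
  define L where "L = leading_row_coeff_mat ds M"
  have cM: "M \<in> carrier_mat m q"
    using M by (auto simp: poly_mats_def)
  then have L: "L \<in> carrier_mat m q"
    by (simp add: L_def leading_row_coeff_mat_def)
  obtain w where w: "normsq m w = 1"
    and min: "normsq q (row_mult m (\<lambda>i j. L $$ (i, j)) w) = (singular_value m L)\<^sup>2"
    using singular_value_attained[OF L \<open>m > 0\<close>] by auto
  define f where "f a i = (if Suc a = k + ds ! i then w i else 0)" for a i
  have "(\<Sum>a<k + ds ! i. (cmod (f a i))\<^sup>2) = (cmod (w i))\<^sup>2" for i
  proof -
    have "(\<Sum>a<k + ds ! i. (cmod (f a i))\<^sup>2)
        = (\<Sum>a<k + ds ! i. if a = k + ds ! i - 1 then (cmod (w i))\<^sup>2 else 0)"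
      using \<open>k > 0\<close> by (intro sum.cong refl) (auto simp: f_def)
    then show ?thesis
      using \<open>k > 0\<close> by simp
  qed
  then have "(\<Sum>i<m. \<Sum>a<k + ds ! i. (cmod (f a i))\<^sup>2) = 1"
    using w by (simp add: normsq_def)
  then have "s\<^sup>2 = s\<^sup>2 * (\<Sum>i<m. \<Sum>a<k + ds ! i. (cmod (f a i))\<^sup>2)"
    by simp
  also have "\<dots> \<le> (\<Sum>b<k. \<Sum>j<q. (cmod (\<Sum>i<m. \<Sum>t\<le>ds ! i. f (b + t) i * coeff (M $$ (i, j)) t))\<^sup>2)"
    using trimmed_sylvester_singular_value_le(2)[OF ds M, of k f] \<open>k > 0\<close> \<open>m > 0\<close>
    by (simp add: s_def)
  also have "\<dots> = (\<Sum>b<k. if b = k - 1 then (singular_value m L)\<^sup>2 else 0)"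
  proof (rule sum.cong[OF refl])
    fix b assume b: "b \<in> {..<k}"
    have inner: "(\<Sum>t\<le>ds ! i. f (b + t) i * coeff (M $$ (i, j)) t)
        = (if b = k - 1 then w i * L $$ (i, j) else 0)" if "i < m" "j < q" for i j
    proof -
      \<comment> \<open>From \<open>b + t + 1 = k + ds ! i\<close>, \<open>b < k\<close> and
        \<open>t\<close> at most \<open>ds ! i\<close>, it follows that \<open>b = k - 1\<close> and
        \<open>t = ds ! i\<close>.\<close>
      have "(\<Sum>t\<le>ds ! i. f (b + t) i * coeff (M $$ (i, j)) t)
          = (\<Sum>t\<le>ds ! i. if t = ds ! i then (if b = k - 1 then w i * coeff (M $$ (i, j)) t else 0) else 0)"
        using b by (intro sum.cong refl) (auto simp: f_def)
      then show ?thesis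
        using cM that by (simp add: L_def leading_row_coeff_mat_def)
    qed
    show "(\<Sum>j<q. (cmod (\<Sum>i<m. \<Sum>t\<le>ds ! i. f (b + t) i * coeff (M $$ (i, j)) t))\<^sup>2)
        = (if b = k - 1 then (singular_value m L)\<^sup>2 else 0)"
      by (simp add: inner min[symmetric] normsq_def row_mult_def)
  qed
  also have "\<dots> = (singular_value m L)\<^sup>2"
    using \<open>k > 0\<close> by simp
  finally show ?thesis
    using singular_value_nonneg[OF L \<open>m > 0\<close>]
    unfolding s_def L_def by (rule power2_le_imp_le)
qed

section \<open>The degenerate case and the conclusion\<close>

text \<open>For \<open>k = 0\<close> the Sylvester matrix has no columns.\<close>

lemma trimmed_sylvester_singular_value_0:
  assumes ds: "length ds = m" and M: "M \<in> poly_mats m q ds" and "sum_list ds > 0"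
  shows "singular_value (sum_list ds) (trimmed_sylvester_mat ds 0 M) = 0"
proof -
  have "(\<Sum>i<m. ds ! i) = sum_list ds"
    using ds by (simp add: sum_list_sum_nth atLeast0LessThan)
  then have "(\<Sum>i<m. real (ds ! i)) > 0"
    using \<open>sum_list ds > 0\<close> by (metis of_nat_0_less_iff of_nat_sum)
  \<comment> \<open>The all-ones test row has squared norm \<open>sum_list ds\<close>, while its
    image is empty.\<close>
  moreover have "(singular_value (sum_list ds) (trimmed_sylvester_mat ds 0 M))\<^sup>2 * (\<Sum>i<m. real (ds ! i)) \<le> 0"
    using trimmed_sylvester_singular_value_le(2)[OF ds M, of 0 "\<lambda>_ _. 1"] assms(3) by simp
  ultimately show ?thesis
    by (simp add: mult_le_0_iff)
qed

theorem theorem9p1: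
  fixes m n d' :: nat and ds :: "nat list" and M :: "complex poly mat"
  assumes "m > 0" and "n > 0"
    and "length ds = m" and "Max (set ds) > 0"
    and "M \<in> poly_mats m (m + n) ds"
    and "minimal_basis_mat M"
    and "vec_space.rank m (leading_row_coeff_mat ds M) = m"
    and "d' = Max (set (right_minimal_indices M))"
  shows "singular_value (d' * m + sum_list ds) (trimmed_sylvester_mat ds d' M)
           \<le> (INF z. singular_value m (eval_poly_mat M z)) \<and>
         singular_value (d' * m + sum_list ds) (trimmed_sylvester_mat ds d' M)
           \<le> singular_value m (leading_row_coeff_mat ds M)"
\<comment> \<open>For \<open>d' = 0\<close> the left side is 0 and both right sides are nonnegative;
  otherwise the two bounds apply with \<open>k = d'\<close>.\<close>
proof (cases "d' = 0")
  case True
  \<comment> \<open>A positive degree sum ensures that the singular value taken here has index at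
    least 1.\<close>
  have "set ds \<noteq> {}"
    using assms(1,3) by auto
  then have "Max (set ds) \<in> set ds"
    by simp
  then have "sum_list ds > 0"
    using assms(4) member_le_sum_list[of "Max (set ds)" ds] by simp
  then have 0: "singular_value (d' * m + sum_list ds) (trimmed_sylvester_mat ds d' M) = 0"
    using trimmed_sylvester_singular_value_0[OF assms(3,5)] True by simp
  have "M \<in> carrier_mat m (m + n)"
    using assms(5) by (simp add: poly_mats_def)
  then have "eval_poly_mat M z \<in> carrier_mat m (m + n)"
    "leading_row_coeff_mat ds M \<in> carrier_mat m (m + n)" for z
    by (simp_all add: eval_poly_mat_def leading_row_coeff_mat_def)
  then show ?thesis
    unfolding 0 using singular_value_nonneg[OF _ assms(1)] by (auto intro!: cINF_greatest)
next
  case False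
  then show ?thesis
    using trimmed_sylvester_singular_value_le_eval[OF assms(3,5)]
      trimmed_sylvester_singular_value_le_leading[OF assms(3,5)] assms(1)
    by (auto intro!: cINF_greatest)
qed

end
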